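(* Let $K\ge 1$ and suppose that all hypotheses are true nulls ($\mathcal N=\mathcal K=\{1,\dots,K\}$), so that $\mathbf P=(P_1,\dots,P_K)$ is a random vector, with an arbitrary joint distribution, each of whose components is a p-variable. Let $\ell_K=\sum_{k=1}^K\frac1k$ and $$S_K(p_1,\dots,p_K)=\min_{1\le k\le K}\frac{K}{k}\,p_{(k)},$$ where $p_{(k)}$ is the $k$-th smallest order statistic of $p_1,\dots,p_K$. Then $$\mathbb P(S_K(\mathbf P)\le\alpha)\le\ell_K\,\alpha\quad\text{for all }\alpha\in[0,1].$$
   Context: A p-variable is a random variable $P$ with $\mathbb P(P\le t)\le t$ for all $t\in(0,1)$; p-values here take values in $[0,\infty)$. *)

theory Defs
  imports "HOL-Probability.Probability"
begin

definition p_variable :: "'a measure \<Rightarrow> ('a \<Rightarrow> real) \<Rightarrow> bool" where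
  "p_variable M X \<longleftrightarrow>
     X \<in> borel_measurable M \<and>
     (\<forall>\<omega>\<in>space M. 0 \<le> X \<omega>) \<and>
     (\<forall>t\<in>{0<..<1}. measure M {\<omega> \<in> space M. X \<omega> \<le> t} \<le> t)"

(* Vectors of length K are functions on nat, read only at the indices 1, ..., K.
   Order statistics are counted from 1 and with multiplicity, list positions from 0. *)

definition order_stat :: "nat \<Rightarrow> (nat \<Rightarrow> real) \<Rightarrow> nat \<Rightarrow> real" where
  "order_stat K p k = sort (map p [1..<Suc K]) ! (k - 1)"

definition simes :: "nat \<Rightarrow> (nat \<Rightarrow> real) \<Rightarrow> real" where
  "simes K p = (MIN k\<in>{1..K}. real K / real k * order_stat K p k)"

end

theory Submission
  imports Defs
begin

text \<open>
  The event that the Simes statistic is at most \<open>\<alpha>\<close> means that, for some \<open>k\<close>, at least \<open>k\<close> of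
  the p-values lie below the threshold \<open>k \<alpha> / K\<close>. Dependence is dealt with by charging
  each p-value separately: the step function \<open>f\<close> equal to \<open>1\<close> for \<open>x \<le> \<alpha> / K\<close>, to \<open>1 / j\<close> on
  the slab \<open>(j - 1) \<alpha> / K < x \<le> j \<alpha> / K\<close> for \<open>2 \<le> j \<le> K\<close>,
  and to \<open>0\<close> beyond, takes values at least \<open>1 / k\<close> at every \<open>x \<le> k \<alpha> / K\<close>, so on the event
  the \<open>K\<close> charges add up to at least \<open>k * (1 / k) = 1\<close>. Markov's inequality
  bounds the probability by the sum of the expected charges, and expectation is linear whatever
  the joint distribution is.

  To use the tail bounds on each p-value, \<open>f\<close> is written by Abel summation as a nonnegative
  combination of the indicators of \<open>x \<le> j \<alpha> / K\<close>; the coefficients are the drops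
  \<open>1 / j - 1 / (j + 1)\<close> for \<open>j < K\<close> and \<open>1 / K\<close> at the end. The indicator of index \<open>j\<close> has
  expectation at most \<open>j \<alpha> / K\<close>, and the coefficients weighted by \<open>j\<close> sum to the harmonic
  number, so each expected charge is at most \<open>\<alpha> / K\<close> times that number. The bridge to order
  statistics is \<open>order_stat_le_imp_card\<close>; the two summations are
  \<open>sum_simes_weight_tail\<close> and \<open>sum_index_simes_weight\<close>.
\<close>

definition simes_weight :: "nat \<Rightarrow> nat \<Rightarrow> real" where
  "simes_weight K j = (if j < K then 1 / real j - 1 / real (Suc j) else 1 / real K)"

lemma simes_weight_nonneg: "1 \<le> j \<Longrightarrow> 0 \<le> simes_weight K j"
  by (auto simp: simes_weight_def field_simps)

text \<open>The value of the step function at a point of the \<open>k\<close>-th slab: the drops telescope.\<close>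

lemma sum_simes_weight_tail:
  assumes "1 \<le> k" "k \<le> K"
  shows "(\<Sum>j=k..K. simes_weight K j) = 1 / real k"
  using assms(2)
proof (induction k rule: inc_induct)
  case base
  then show ?case by (simp add: simes_weight_def)
next
  case (step n)
  then show ?case
    by (subst sum.atLeast_Suc_atMost) (auto simp: simes_weight_def)
qed

text \<open>Each drop contributes \<open>j * (1 / j - 1 / (j + 1)) = 1 / (j + 1)\<close>, which gives the harmonic
  sum from its second term on; the last coefficient supplies the missing \<open>1\<close>.\<close>

lemma sum_index_simes_weight:
  assumes "1 \<le> K"
  shows "(\<Sum>j=1..K. real j * simes_weight K j) = (\<Sum>k=1..K. 1 / real k)"
proof -
  obtain n where K: "K = Suc n"
    using assms by (cases K) auto
  have "(\<Sum>j=1..K. real j * simes_weight K j) = (\<Sum>j=1..n. real j * simes_weight K j) + 1"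
    by (simp add: K simes_weight_def)
  also have "(\<Sum>j=1..n. real j * simes_weight K j) = (\<Sum>j=1..n. 1 / real (Suc j))"
    by (intro sum.cong) (auto simp: K simes_weight_def right_diff_distrib diff_divide_eq_iff)
  also have "\<dots> + 1 = (\<Sum>k=1..K. 1 / real k)"
    unfolding K by (subst sum.atLeast_Suc_atMost)
      (simp_all add: sum.shift_bounds_cl_Suc_ivl del: sum.cl_ivl_Suc)
  finally show ?thesis .
qed

text \<open>The first \<open>k\<close> entries of the sorted list are at most the \<open>k\<close>-th one, and sorting preserves
  the number of entries below a level.\<close>

lemma order_stat_le_imp_card:
  assumes "1 \<le> k" "k \<le> K" "order_stat K p k \<le> t"
  shows "k \<le> card {i\<in>{1..K}. p i \<le> t}"
proof -
  let ?xs = "map p [1..<Suc K]"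
  have "sort ?xs ! i \<le> t" if "i < k" for i
  proof -
    have "sort ?xs ! i \<le> sort ?xs ! (k - 1)"
      using that assms by (intro sorted_nth_mono) auto
    with assms(3) show ?thesis by (simp add: order_stat_def)
  qed
  then have "{..<k} \<subseteq> {i. i < length (sort ?xs) \<and> sort ?xs ! i \<le> t}"
    using assms by auto
  then have "k \<le> card {i. i < length (sort ?xs) \<and> sort ?xs ! i \<le> t}"
    using card_mono[of "{i. i < length (sort ?xs) \<and> sort ?xs ! i \<le> t}" "{..<k}"] by simp
  also have "\<dots> = length (filter (\<lambda>x. x \<le> t) (sort ?xs))"
    by (simp only: length_filter_conv_card)
  also have "\<dots> = length (filter (\<lambda>i. p i \<le> t) [1..<Suc K])"
    by (simp only: filter_sort length_sort filter_map length_map comp_def)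
  also have "\<dots> = card (set (filter (\<lambda>i. p i \<le> t) [1..<Suc K]))"
    by (rule distinct_card[symmetric]) (simp del: upt_Suc)
  also have "set (filter (\<lambda>i. p i \<le> t) [1..<Suc K]) = {i\<in>{1..K}. p i \<le> t}"
    by (auto simp del: upt_Suc)
  finally show ?thesis .
qed

lemma simes_le_imp_card:
  assumes "1 \<le> K" "simes K p \<le> \<alpha>"
  obtains k where "k \<in> {1..K}" "k \<le> card {i\<in>{1..K}. p i \<le> real k * \<alpha> / real K}"
proof -
  have "simes K p \<in> (\<lambda>k. real K / real k * order_stat K p k) ` {1..K}"
    unfolding simes_def using assms(1) by (intro Min_in) auto
  then obtain k where k: "k \<in> {1..K}" "simes K p = real K / real k * order_stat K p k"
    by auto
  then have "order_stat K p k = real k * simes K p / real K"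
    using assms(1) by simp
  also have "\<dots> \<le> real k * \<alpha> / real K"
    using assms by (intro divide_right_mono mult_left_mono) auto
  finally have "order_stat K p k \<le> real k * \<alpha> / real K" .
  with k order_stat_le_imp_card[of k K p] that show thesis by auto
qed

text \<open>The deterministic core: for some \<open>k\<close>, at least \<open>k\<close> entries lie below the \<open>k\<close>-th threshold.
  Each of them is charged at least \<open>1 / k\<close>, since it lies below all later thresholds too.\<close>

lemma one_le_sum_weighted_indicators:
  assumes "1 \<le> K" "0 \<le> \<alpha>" "simes K p \<le> \<alpha>"
  shows "1 \<le> (\<Sum>i=1..K. \<Sum>j=1..K. simes_weight K j * indicator {..real j * \<alpha> / real K} (p i))"
    (is "1 \<le> (\<Sum>i=1..K. ?f (p i))")
proof -
  obtain k where k: "k \<in> {1..K}" "k \<le> card {i\<in>{1..K}. p i \<le> real k * \<alpha> / real K}" (is "_ \<le> card ?I")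
    using simes_le_imp_card[OF assms(1,3)] by blast
  have nonneg: "0 \<le> ?f x" for x
    by (intro sum_nonneg mult_nonneg_nonneg simes_weight_nonneg) auto
  have charge: "1 / real k \<le> ?f (p i)" if "i \<in> ?I" for i
  proof -
    have below: "p i \<le> real j * \<alpha> / real K" if "j \<in> {k..K}" for j
    proof -
      have "real k * \<alpha> / real K \<le> real j * \<alpha> / real K"
        using that assms by (intro divide_right_mono mult_right_mono) auto
      with \<open>i \<in> ?I\<close> show ?thesis by simp
    qed
    have "1 / real k = (\<Sum>j=k..K. simes_weight K j * indicator {..real j * \<alpha> / real K} (p i))"
      using k(1) below by (subst sum_simes_weight_tail[symmetric]) (auto intro!: sum.cong)
    also have "\<dots> \<le> ?f (p i)"
      using k(1) by (intro sum_mono2) (auto intro!: mult_nonneg_nonneg simes_weight_nonneg)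
    finally show ?thesis .
  qed
  have "1 \<le> real (card ?I) * (1 / real k)"
    using k by (simp add: field_simps)
  also have "\<dots> \<le> (\<Sum>i\<in>?I. ?f (p i))"
    using sum_mono[of ?I "\<lambda>_. 1 / real k" "\<lambda>i. ?f (p i)"] charge by simp
  also have "\<dots> \<le> (\<Sum>i=1..K. ?f (p i))"
    by (intro sum_mono2 nonneg) auto
  finally show ?thesis .
qed

text \<open>The bound defining a p-variable extends to the endpoints: at \<open>0\<close> by comparison with small
  positive levels, at \<open>1\<close> because probabilities are at most \<open>1\<close>.\<close>

lemma p_variable_prob_le:
  assumes "prob_space M" "p_variable M X" "0 \<le> t" "t \<le> 1"
  shows "measure M {\<omega> \<in> space M. X \<omega> \<le> t} \<le> t"
proof -
  interpret prob_space M by fact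
  have meas [measurable]: "X \<in> borel_measurable M"
    and tail: "\<And>s. 0 < s \<Longrightarrow> s < 1 \<Longrightarrow> prob {\<omega> \<in> space M. X \<omega> \<le> s} \<le> s"
    using assms(2) by (auto simp: p_variable_def)
  show ?thesis
  proof (cases "t = 1")
    case True
    then show ?thesis by simp
  next
    case False
    show ?thesis
    proof (rule dense_ge_bounded[of t 1])
      show "t < 1" using False assms by simp
    next
      fix s assume s: "t < s" "s < 1"
      have "prob {\<omega> \<in> space M. X \<omega> \<le> t} \<le> prob {\<omega> \<in> space M. X \<omega> \<le> s}"
        using s by (intro finite_measure_mono) auto
      also have "\<dots> \<le> s"
        using s assms by (intro tail) auto
      finally show "prob {\<omega> \<in> space M. X \<omega> \<le> t} \<le> s" .
    qed
  qed
qed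

theorem corollary2:
  fixes M :: "'a measure" and K :: nat and P :: "nat \<Rightarrow> 'a \<Rightarrow> real"
  assumes "prob_space M"
    and "K \<ge> 1"
    and "\<forall>k\<in>{1..K}. p_variable M (P k)"
  shows "\<forall>\<alpha>\<in>{0..1}.
    measure M {\<omega> \<in> space M. simes K (\<lambda>k. P k \<omega>) \<le> \<alpha>} \<le> (\<Sum>k=1..K. 1 / real k) * \<alpha>"
proof
  fix \<alpha> :: real assume "\<alpha> \<in> {0..1}"
  then have \<alpha>: "0 \<le> \<alpha>" "\<alpha> \<le> 1" by auto
  interpret prob_space M by fact
  define B where "B i j = {\<omega> \<in> space M. P i \<omega> \<le> real j * \<alpha> / real K}" for i j
  define Z where "Z \<omega> = (\<Sum>i=1..K. \<Sum>j=1..K. simes_weight K j * indicator (B i j) \<omega>)" for \<omega>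
  have B_sets: "B i j \<in> sets M" if "i \<in> {1..K}" for i j
  proof -
    have [measurable]: "P i \<in> borel_measurable M"
      using assms(3) that by (auto simp: p_variable_def)
    show ?thesis unfolding B_def by measurable
  qed
  have int: "integrable M (\<lambda>\<omega>. simes_weight K j * indicator (B i j) \<omega>)" if "i \<in> {1..K}" for i j
    using B_sets[OF that]
    by (intro integrable_mult_right integrable_real_indicator) (auto simp: emeasure_eq_measure)
  have Z_int: "integrable M Z"
    unfolding Z_def by (intro Bochner_Integration.integrable_sum int)
  have Z_nonneg: "0 \<le> Z \<omega>" for \<omega>
    unfolding Z_def by (intro sum_nonneg mult_nonneg_nonneg simes_weight_nonneg) auto
  have Z_ge: "1 \<le> Z \<omega>" if "\<omega> \<in> space M" "simes K (\<lambda>k. P k \<omega>) \<le> \<alpha>" for \<omega>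
  proof -
    have "indicator (B i j) \<omega> = (indicator {..real j * \<alpha> / real K} (P i \<omega>) :: real)" for i j
      using that(1) by (auto simp: B_def indicator_def)
    then show ?thesis
      using one_le_sum_weighted_indicators[OF assms(2) \<alpha>(1) that(2)] by (simp add: Z_def)
  qed
  have prob_B: "prob (B i j) \<le> real j * \<alpha> / real K" if "i \<in> {1..K}" "j \<in> {1..K}" for i j
  proof -
    have "real j * \<alpha> \<le> real K * 1"
      using that \<alpha> by (intro mult_mono) auto
    then show ?thesis
      unfolding B_def using that assms \<alpha>
      by (intro p_variable_prob_le) (auto simp: field_simps)
  qed

  \<comment> \<open>The larger event is measurable because \<open>Z\<close> is, which is what monotonicity of the
    measure asks for.\<close>
  have "prob {\<omega> \<in> space M. simes K (\<lambda>k. P k \<omega>) \<le> \<alpha>} \<le> prob {\<omega> \<in> space M. 1 \<le> Z \<omega>}"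
    using Z_ge borel_measurable_integrable[OF Z_int] by (intro finite_measure_mono) auto
  also have "\<dots> \<le> expectation Z"
    using integral_Markov_inequality_measure[of M Z "{}" 1] Z_int Z_nonneg by auto
  also have "\<dots> = (\<Sum>i=1..K. \<Sum>j=1..K. expectation (\<lambda>\<omega>. simes_weight K j * indicator (B i j) \<omega>))"
    unfolding Z_def
    by (simp only: int Bochner_Integration.integral_sum Bochner_Integration.integrable_sum cong: sum.cong)
  also have "\<dots> = (\<Sum>i=1..K. \<Sum>j=1..K. simes_weight K j * prob (B i j))"
    using B_sets by (intro sum.cong) auto
  also have "\<dots> \<le> (\<Sum>i=1..K. \<Sum>j=1..K. simes_weight K j * (real j * \<alpha> / real K))"
    by (intro sum_mono mult_left_mono prob_B simes_weight_nonneg) auto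
  also have "\<dots> = (\<Sum>j=1..K. real j * simes_weight K j) * \<alpha>"
    using assms(2) by (simp add: sum_distrib_left sum_distrib_right mult_ac)
  also have "\<dots> = (\<Sum>k=1..K. 1 / real k) * \<alpha>"
    by (simp only: sum_index_simes_weight[OF assms(2)])
  finally show "prob {\<omega> \<in> space M. simes K (\<lambda>k. P k \<omega>) \<le> \<alpha>} \<le> (\<Sum>k=1..K. 1 / real k) * \<alpha>" .
qed

end
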